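(* Let $\{u_i\}_{i\in\mathbb N}$ be a uniformly computable family of block-density profiles, and let $D\subseteq\mathbb N^2$ be a computable set of ordered pairs. Assume that for each $(i,j)\in D$ we are given, uniformly computably in $(i,j)$, (i) a rational number $\delta_{i,j}>0$; and (ii) a strictly increasing computable function $s_{i,j}:\mathbb N\to\mathbb N$ with infinite range $S_{i,j}=\{s_{i,j}(t):t\in\mathbb N\}$, such that $u_i(k)\ge u_j(k)+\delta_{i,j}$ for every $k\in S_{i,j}$. Then there exist a set $A\subseteq\mathbb N$, computable in $\emptyset'$, and a uniformly computable family of total surjective functions $h_i:\mathbb N\to\mathbb N$ ($i\in\mathbb N$), such that, writing $I_k=[a_k,a_{k+1})$ with $a_0=0$ and $a_{k+1}=a_k+k!$, the following hold: (a) $A$ is constant on each block $I_k$. (b) Each $h_i$ is bounded finite-one with global bound $2$, i.e. $|h_i^{-1}(y)|\le 2$ for all $y\in\mathbb N$. (c) For $C_i(x)=A(h_i(x))$, one has $C_i\equiv_{\rm bfo}A$ for every $i\in\mathbb N$. (d) If $u_i(k)\le u_j(k)$ for every $k\in\mathbb N$, then $C_i\le_1 C_j$. (e) If $(i,j)\in D$, then $C_i\not\le_1 C_j$. In particular, whenever $u_i(k)\le u_j(k)$ for all $k\in\mathbb N$ and $(j,i)\in D$, one has $C_i<_1 C_j$.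
   Context: Sets $A\subseteq\mathbb N=\{0,1,\dots\}$ are identified with their characteristic functions: $A(x)=1$ if $x\in A$, $A(x)=0$ otherwise. $\emptyset'$ is the Turing jump of the empty set (the halting set). Intervals $[a,b)$ are intervals of natural numbers. A block-density profile is a total function $u:\mathbb N\to\mathbb Q\cap(1,2)$. A family $\{u_i\}_{i\in\mathbb N}$ of block-density profiles is uniformly computable if $(i,k)\mapsto u_i(k)$ is computable. Likewise the family $h_i$ is uniformly computable if $(i,x)\mapsto h_i(x)$ is computable, and "uniformly computably in $(i,j)$" means that $(i,j)\mapsto\delta_{i,j}$ and $(i,j,t)\mapsto s_{i,j}(t)$ are computable for $(i,j)\in D$. For $A,B\subseteq\mathbb N$: $A\le_1 B$ means there is a total computable injective $f:\mathbb N\to\mathbb N$ with $x\in A\iff f(x)\in B$ for all $x$. $A\le_{\rm bfo}B$ means there are a total computable $f:\mathbb N\to\mathbb N$ and a constant $c\ge1$ with $x\in A\iff f(x)\in B$ for all $x$ and $|f^{-1}(y)|\le c$ for all $y\in\mathbb N$. For $r\in\{1,{\rm bfo}\}$, $A\equiv_r B$ means $A\le_r B$ and $B\le_r A$; $A<_r B$ means $A\le_r B$ and $B\not\le_r A$. *)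

theory Defs
  imports Complex_Main "HOL-Library.Nat_Bijection"
begin

section \<open>Partial recursive functions relative to a set\<close>

text \<open>
  Kleene's partial recursive functions, presented as unary functions on \<open>nat\<close>: several arguments
  are packed with the Cantor pairing \<open>prod_encode\<close>, which is why pairing and its projections
  are basic functions. \<open>Query\<close> is the characteristic function of the set relativised to.
\<close>

datatype prog =
    Zero
  | Succ
  | Proj1
  | Proj2
  | Query
  | Tuple prog prog
  | Comp prog prog
  | PrimRec prog prog
  | Mu prog

text \<open>
  \<open>None\<close> means divergence. Evaluation is strict: in particular, \<open>Mu f\<close> at \<open>a\<close> returns \<open>n\<close> only if
  \<open>f\<close> converges at \<open>(a, m)\<close> for all \<open>m < n\<close>.
\<close>

primrec eval :: "nat set \<Rightarrow> prog \<Rightarrow> nat \<Rightarrow> nat option" where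
  "eval B Zero = (\<lambda>x. Some 0)"
| "eval B Succ = (\<lambda>x. Some (Suc x))"
| "eval B Proj1 = (\<lambda>x. Some (fst (prod_decode x)))"
| "eval B Proj2 = (\<lambda>x. Some (snd (prod_decode x)))"
| "eval B Query = (\<lambda>x. Some (of_bool (x \<in> B)))"
| "eval B (Tuple f g) = (\<lambda>x. Option.bind (eval B f x) (\<lambda>y.
     Option.bind (eval B g x) (\<lambda>z. Some (prod_encode (y, z)))))"
| "eval B (Comp f g) = (\<lambda>x. Option.bind (eval B g x) (eval B f))"
| "eval B (PrimRec f g) = (\<lambda>x. case prod_decode x of (a, n) \<Rightarrow>
     rec_nat (eval B f a)
       (\<lambda>m r. Option.bind r (\<lambda>y. eval B g (prod_encode (a, prod_encode (m, y))))) n)"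
| "eval B (Mu f) = (\<lambda>a.
     let P = (\<lambda>n. eval B f (prod_encode (a, n)) = Some 0 \<and>
                  (\<forall>m<n. \<exists>y. eval B f (prod_encode (a, m)) = Some (Suc y)))
     in if \<exists>n. P n then Some (LEAST n. P n) else None)"

text \<open>
  An explicit Goedel numbering. Numbers that are not the code of a program are regarded as indices of
  the nowhere defined function.
\<close>

primrec prog_code :: "prog \<Rightarrow> nat" where
  "prog_code Zero = prod_encode (0, 0)"
| "prog_code Succ = prod_encode (1, 0)"
| "prog_code Proj1 = prod_encode (2, 0)"
| "prog_code Proj2 = prod_encode (3, 0)"
| "prog_code Query = prod_encode (4, 0)"
| "prog_code (Tuple f g) = prod_encode (5, prod_encode (prog_code f, prog_code g))"
| "prog_code (Comp f g) = prod_encode (6, prod_encode (prog_code f, prog_code g))"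
| "prog_code (PrimRec f g) = prod_encode (7, prod_encode (prog_code f, prog_code g))"
| "prog_code (Mu f) = prod_encode (8, prog_code f)"

lemma prog_code_inject: "prog_code p = prog_code q \<Longrightarrow> p = q"
proof (induction p arbitrary: q)
  case Zero then show ?case by (cases q) auto
next
  case Succ then show ?case by (cases q) auto
next
  case Proj1 then show ?case by (cases q) auto
next
  case Proj2 then show ?case by (cases q) auto
next
  case Query then show ?case by (cases q) auto
next
  case (Tuple f g) then show ?case by (cases q) auto
next
  case (Comp f g) then show ?case by (cases q) auto
next
  case (PrimRec f g) then show ?case by (cases q) auto
next
  case (Mu f) then show ?case by (cases q) auto
qed

definition jump :: "nat set \<Rightarrow> nat set" where
  "jump B = {e. \<exists>p. prog_code p = e \<and> eval B p e \<noteq> None}"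

section \<open>Computable functions and sets\<close>

text \<open>
  Outside \<open>X\<close> the program is unconstrained. For computable \<open>X\<close> this agrees with
  computability of the extension of \<open>f\<close> by \<open>0\<close>.
\<close>

definition computable_on :: "nat set \<Rightarrow> (nat \<Rightarrow> nat) \<Rightarrow> bool" where
  "computable_on X f \<longleftrightarrow> (\<exists>p. \<forall>x\<in>X. eval {} p x = Some (f x))"

definition computable :: "(nat \<Rightarrow> nat) \<Rightarrow> bool" where
  "computable f \<longleftrightarrow> computable_on UNIV f"

definition set_computable_in :: "nat set \<Rightarrow> nat set \<Rightarrow> bool" where
  "set_computable_in B A \<longleftrightarrow> (\<exists>p. \<forall>x. eval B p x = Some (of_bool (x \<in> A)))"

definition computable_set :: "nat set \<Rightarrow> bool" where
  "computable_set A \<longleftrightarrow> set_computable_in {} A"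

definition rat_encode :: "rat \<Rightarrow> nat" where
  "rat_encode r = (case quotient_of r of (p, q) \<Rightarrow> prod_encode (int_encode p, nat q))"

definition uncurry2 :: "(nat \<Rightarrow> nat \<Rightarrow> nat) \<Rightarrow> nat \<Rightarrow> nat" where
  "uncurry2 f = (\<lambda>z. case prod_decode z of (x, y) \<Rightarrow> f x y)"

definition uncurry3 :: "(nat \<Rightarrow> nat \<Rightarrow> nat \<Rightarrow> nat) \<Rightarrow> nat \<Rightarrow> nat" where
  "uncurry3 f = uncurry2 (\<lambda>w t. case prod_decode w of (x, y) \<Rightarrow> f x y t)"

section \<open>Reducibilities\<close>

definition one_reducible :: "nat set \<Rightarrow> nat set \<Rightarrow> bool" (infix \<open>\<le>\<^sub>1\<close> 50) where
  "A \<le>\<^sub>1 B \<longleftrightarrow> (\<exists>f. computable f \<and> inj f \<and> (\<forall>x. x \<in> A \<longleftrightarrow> f x \<in> B))"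

definition one_less :: "nat set \<Rightarrow> nat set \<Rightarrow> bool" (infix \<open><\<^sub>1\<close> 50) where
  "A <\<^sub>1 B \<longleftrightarrow> A \<le>\<^sub>1 B \<and> \<not> B \<le>\<^sub>1 A"

definition fibres_bounded :: "(nat \<Rightarrow> nat) \<Rightarrow> nat \<Rightarrow> bool" where
  "fibres_bounded f c \<longleftrightarrow> (\<forall>y. finite (f -` {y}) \<and> card (f -` {y}) \<le> c)"

definition bfo_reducible :: "nat set \<Rightarrow> nat set \<Rightarrow> bool" (infix \<open>\<le>\<^sub>b\<^sub>f\<^sub>o\<close> 50) where
  "A \<le>\<^sub>b\<^sub>f\<^sub>o B \<longleftrightarrow>
     (\<exists>f c. computable f \<and> 1 \<le> c \<and> (\<forall>x. x \<in> A \<longleftrightarrow> f x \<in> B) \<and> fibres_bounded f c)"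

definition bfo_equivalent :: "nat set \<Rightarrow> nat set \<Rightarrow> bool" (infix \<open>\<equiv>\<^sub>b\<^sub>f\<^sub>o\<close> 50) where
  "A \<equiv>\<^sub>b\<^sub>f\<^sub>o B \<longleftrightarrow> A \<le>\<^sub>b\<^sub>f\<^sub>o B \<and> B \<le>\<^sub>b\<^sub>f\<^sub>o A"

section \<open>Profiles and blocks\<close>

definition block_density_profile :: "(nat \<Rightarrow> rat) \<Rightarrow> bool" where
  "block_density_profile u \<longleftrightarrow> (\<forall>k. 1 < u k \<and> u k < 2)"

primrec block_start :: "nat \<Rightarrow> nat" where
  "block_start 0 = 0"
| "block_start (Suc k) = block_start k + fact k"

definition block :: "nat \<Rightarrow> nat set" where
  "block k = {block_start k..<block_start (Suc k)}"

end

theory Submission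
  imports Defs
begin

text \<open>
  The map \<open>h\<^sub>i\<close> wraps consecutive intervals of lengths \<open>\<lfloor>u\<^sub>i(k) k!\<rfloor>\<close> around the blocks of length
  \<open>k!\<close>, so that \<open>C\<^sub>i\<close> is \<open>A\<close> with its \<open>k\<close>-th block stretched by the factor \<open>u\<^sub>i(k)\<close>. If
  \<open>u\<^sub>i \<le> u\<^sub>j\<close>, the intervals of \<open>C\<^sub>i\<close> embed into those of \<open>C\<^sub>j\<close>. If \<open>u\<^sub>i(k) \<ge> u\<^sub>j(k) + \<delta>\<close>
  for infinitely many \<open>k\<close>, then for some large such \<open>k\<close> the \<open>k\<close>-th interval of \<open>C\<^sub>i\<close> is longer than
  the first \<open>k + 1\<close> intervals of \<open>C\<^sub>j\<close> together, because \<open>0! + \<dots> + (k-1)! = o(k!)\<close>. An injection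
  must therefore send some point of it into a later interval \<open>k'\<close> of \<open>C\<^sub>j\<close>, and it suffices that
  \<open>A\<close> takes different values on the blocks \<open>k\<close> and \<open>k'\<close>. The halting set can determine the last
  interval reached, so a finite extension construction below \<open>\<emptyset>'\<close> handles all programs and pairs.
\<close>

section \<open>Closure properties of relative computability\<close>

definition computable_in :: "nat set \<Rightarrow> (nat \<Rightarrow> nat) \<Rightarrow> bool" where
  "computable_in B f \<longleftrightarrow> (\<exists>p. \<forall>x. eval B p x = Some (f x))"

abbreviation decidable_in :: "nat set \<Rightarrow> (nat \<Rightarrow> bool) \<Rightarrow> bool" where
  "decidable_in B P \<equiv> computable_in B (\<lambda>x. of_bool (P x))"

abbreviation pfst :: "nat \<Rightarrow> nat" where
  "pfst z \<equiv> fst (prod_decode z)"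

abbreviation psnd :: "nat \<Rightarrow> nat" where
  "psnd z \<equiv> snd (prod_decode z)"

lemma computable_eq_computable_in: "computable f \<longleftrightarrow> computable_in {} f"
  by (simp add: computable_def computable_on_def computable_in_def)

lemma set_computable_in_eq: "set_computable_in B A \<longleftrightarrow> decidable_in B (\<lambda>x. x \<in> A)"
  by (simp add: set_computable_in_def computable_in_def)

text \<open>\<open>Zero\<close> is the characteristic function of the empty set, so the rewritten
  program behaves under every oracle as the original does under the empty one. This transfers
  computability to any oracle.\<close>

primrec query_free :: "prog \<Rightarrow> prog" where
  "query_free Zero = Zero"
| "query_free Succ = Succ"
| "query_free Proj1 = Proj1"
| "query_free Proj2 = Proj2"
| "query_free Query = Zero"
| "query_free (Tuple f g) = Tuple (query_free f) (query_free g)"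
| "query_free (Comp f g) = Comp (query_free f) (query_free g)"
| "query_free (PrimRec f g) = PrimRec (query_free f) (query_free g)"
| "query_free (Mu f) = Mu (query_free f)"

lemma eval_query_free: "eval B (query_free p) = eval {} p"
  by (induction p) simp_all

lemma computable_in_mono: "computable_in {} f \<Longrightarrow> computable_in B f"
  unfolding computable_in_def by (metis eval_query_free)

lemma computable_in_compose:
  assumes "computable_in B f" "computable_in B g"
  shows "computable_in B (\<lambda>x. f (g x))"
proof -
  obtain p q where "\<forall>x. eval B p x = Some (f x)" "\<forall>x. eval B q x = Some (g x)"
    using assms unfolding computable_in_def by blast
  then have "\<forall>x. eval B (Comp p q) x = Some (f (g x))" by simp
  then show ?thesis unfolding computable_in_def by blast
qed

lemma computable_in_pair:
  assumes "computable_in B f" "computable_in B g"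
  shows "computable_in B (\<lambda>x. prod_encode (f x, g x))"
proof -
  obtain p q where "\<forall>x. eval B p x = Some (f x)" "\<forall>x. eval B q x = Some (g x)"
    using assms unfolding computable_in_def by blast
  then have "\<forall>x. eval B (Tuple p q) x = Some (prod_encode (f x, g x))" by simp
  then show ?thesis unfolding computable_in_def by blast
qed

lemma computable_in_Suc:
  assumes "computable_in B f"
  shows "computable_in B (\<lambda>x. Suc (f x))"
proof (rule computable_in_compose[OF _ assms])
  have "\<forall>x. eval B Succ x = Some (Suc x)" by simp
  then show "computable_in B Suc" unfolding computable_in_def by blast
qed

lemma computable_in_pfst:
  assumes "computable_in B f"
  shows "computable_in B (\<lambda>x. pfst (f x))"
proof (rule computable_in_compose[OF _ assms])
  have "\<forall>x. eval B Proj1 x = Some (pfst x)" by simp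
  then show "computable_in B pfst" unfolding computable_in_def by blast
qed

lemma computable_in_psnd:
  assumes "computable_in B f"
  shows "computable_in B (\<lambda>x. psnd (f x))"
proof (rule computable_in_compose[OF _ assms])
  have "\<forall>x. eval B Proj2 x = Some (psnd x)" by simp
  then show "computable_in B psnd" unfolding computable_in_def by blast
qed

lemma decidable_in_oracle:
  assumes "computable_in B f"
  shows "decidable_in B (\<lambda>x. f x \<in> B)"
proof (rule computable_in_compose[OF _ assms])
  have "\<forall>x. eval B Query x = Some (of_bool (x \<in> B))" by simp
  then show "decidable_in B (\<lambda>x. x \<in> B)" unfolding computable_in_def by blast
qed

lemma computable_in_id: "computable_in B (\<lambda>x. x)"
proof -
  have "\<forall>x. eval B (Tuple Proj1 Proj2) x = Some x" by simp
  then show ?thesis unfolding computable_in_def by blast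
qed

text \<open>The unary build-up makes the code of \<open>const_prog n\<close> primitive recursive in
  \<open>n\<close>, so that halting questions about given inputs can be written down
  effectively.\<close>

primrec const_prog :: "nat \<Rightarrow> prog" where
  "const_prog 0 = Zero"
| "const_prog (Suc n) = Comp Succ (const_prog n)"

lemma eval_const_prog: "eval B (const_prog n) x = Some n"
  by (induction n) simp_all

lemma computable_in_const: "computable_in B (\<lambda>x. c)"
  unfolding computable_in_def using eval_const_prog by blast

text \<open>The triple \<open>(x, (m, y))\<close> unpacked in the third hypothesis is what
  \<open>PrimRec\<close> feeds to its step program: parameter, counter and previous value.\<close>

lemma computable_in_rec_nat:
  assumes n: "computable_in B n" and f: "computable_in B f"
    and g: "computable_in B (\<lambda>z. g (pfst z) (pfst (psnd z)) (psnd (psnd z)))"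
  shows "computable_in B (\<lambda>x. rec_nat (f x) (g x) (n x))"
proof -
  obtain p q where p: "\<forall>x. eval B p x = Some (f x)"
    and q: "\<forall>z. eval B q z = Some (g (pfst z) (pfst (psnd z)) (psnd (psnd z)))"
    using f g unfolding computable_in_def by blast
  have "rec_nat (Some (f a)) (\<lambda>m r. Option.bind r (\<lambda>y. Some (g a m y))) k
      = Some (rec_nat (f a) (g a) k)" for a k
    by (induction k) simp_all
  then have "\<forall>z. eval B (PrimRec p q) z = Some (rec_nat (f (pfst z)) (g (pfst z)) (psnd z))"
    using p q by (simp add: split_beta)
  then have "computable_in B (\<lambda>z. rec_nat (f (pfst z)) (g (pfst z)) (psnd z))"
    unfolding computable_in_def by blast
  from computable_in_compose[OF this computable_in_pair[OF computable_in_id n]]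
  show ?thesis by simp
qed

lemmas computable_in_basic =
  computable_in_id computable_in_const computable_in_pair computable_in_Suc
  computable_in_pfst computable_in_psnd computable_in_rec_nat

section \<open>Case distinction, Boolean connectives and arithmetic\<close>

lemma computable_in_if:
  assumes "decidable_in B P" "computable_in B f" "computable_in B g"
  shows "computable_in B (\<lambda>x. if P x then f x else g x)"
proof -
  \<comment> \<open>A recursion of length 0 or 1, with the truth value as its counter.\<close>
  have "computable_in B (\<lambda>x. rec_nat (g x) (\<lambda>_ _. f x) (of_bool (P x)))"
    by (intro computable_in_basic assms computable_in_compose[OF assms(2)])
  moreover have "rec_nat (g x) (\<lambda>_ _. f x) (of_bool (P x)) = (if P x then f x else g x)" for x
    by simp
  ultimately show ?thesis by simp
qed

lemma decidable_in_not:
  assumes "decidable_in B P"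
  shows "decidable_in B (\<lambda>x. \<not> P x)"
proof -
  have "computable_in B (\<lambda>x. if P x then 0 else 1)"
    by (intro computable_in_if computable_in_const assms)
  moreover have "of_bool (\<not> P x) = (if P x then 0 else 1 :: nat)" for x by simp
  ultimately show ?thesis by presburger
qed

lemma decidable_in_conj:
  assumes "decidable_in B P" "decidable_in B Q"
  shows "decidable_in B (\<lambda>x. P x \<and> Q x)"
proof -
  have "computable_in B (\<lambda>x. if P x then of_bool (Q x) else 0)"
    by (intro computable_in_if computable_in_const assms)
  moreover have "of_bool (P x \<and> Q x) = (if P x then of_bool (Q x) else 0 :: nat)" for x by simp
  ultimately show ?thesis by presburger
qed

lemma decidable_in_disj:
  assumes "decidable_in B P" "decidable_in B Q"
  shows "decidable_in B (\<lambda>x. P x \<or> Q x)"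
proof -
  have "decidable_in B (\<lambda>x. \<not> (\<not> P x \<and> \<not> Q x))"
    by (intro decidable_in_not decidable_in_conj assms)
  then show ?thesis by simp
qed

lemma decidable_in_imp:
  assumes "decidable_in B P" "decidable_in B Q"
  shows "decidable_in B (\<lambda>x. P x \<longrightarrow> Q x)"
  unfolding imp_conv_disj by (intro decidable_in_not decidable_in_disj assms)

lemma computable_in_plus:
  assumes "computable_in B f" "computable_in B g"
  shows "computable_in B (\<lambda>x. f x + g x)"
proof -
  have "rec_nat a (\<lambda>_. Suc) n = a + n" for a n by (induction n) simp_all
  moreover have "computable_in B (\<lambda>x. rec_nat (f x) (\<lambda>_. Suc) (g x))"
    by (intro computable_in_basic assms)
  ultimately show ?thesis by simp
qed

lemma computable_in_mult:
  assumes "computable_in B f" "computable_in B g"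
  shows "computable_in B (\<lambda>x. f x * g x)"
proof -
  have "rec_nat 0 (\<lambda>_ r. r + a) n = a * n" for a n :: nat by (induction n) simp_all
  moreover have "computable_in B (\<lambda>x. rec_nat 0 (\<lambda>_ r. r + f x) (g x))"
    by (intro computable_in_basic computable_in_plus assms computable_in_compose[OF assms(1)])
  ultimately show ?thesis by simp
qed

lemma computable_in_diff:
  assumes "computable_in B f" "computable_in B g"
  shows "computable_in B (\<lambda>x. f x - g x)"
proof -
  \<comment> \<open>The predecessor is a recursion that returns its counter; iterating it gives
    truncated subtraction.\<close>
  have "rec_nat 0 (\<lambda>m _. m) n = n - 1" for n :: nat by (cases n) simp_all
  moreover have "rec_nat a (\<lambda>_ r. r - 1) n = a - n" for a n :: nat by (induction n) simp_all
  moreover have "computable_in B (\<lambda>x. rec_nat (f x) (\<lambda>_ r. rec_nat 0 (\<lambda>m _. m) r) (g x))"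
    by (intro computable_in_basic assms)
  ultimately show ?thesis by simp
qed

lemma decidable_in_le:
  assumes "computable_in B f" "computable_in B g"
  shows "decidable_in B (\<lambda>x. f x \<le> g x)"
proof -
  have "computable_in B (\<lambda>x. rec_nat 1 (\<lambda>_ _. 0) (f x - g x))"
    by (intro computable_in_basic computable_in_diff assms)
  moreover have "rec_nat 1 (\<lambda>_ _. 0) (a - b) = (of_bool (a \<le> b) :: nat)" for a b :: nat
    by (cases "a - b") simp_all
  ultimately show ?thesis by simp
qed

lemma decidable_in_less:
  assumes "computable_in B f" "computable_in B g"
  shows "decidable_in B (\<lambda>x. f x < g x)"
  unfolding less_eq_Suc_le by (intro decidable_in_le computable_in_Suc assms)

lemma decidable_in_eq:
  assumes "computable_in B f" "computable_in B g"
  shows "decidable_in B (\<lambda>x. f x = g x)"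
  unfolding eq_iff by (intro decidable_in_conj decidable_in_le assms)

section \<open>Unbounded search, bounded quantifiers and functions obtained from them\<close>

lemma computable_in_Least:
  assumes P: "decidable_in B (\<lambda>z. P (pfst z) (psnd z))" and ex: "\<And>x. \<exists>n. P x n"
  shows "computable_in B (\<lambda>x. LEAST n. P x n)"
proof -
  \<comment> \<open>\<open>Mu\<close> stops at the first value 0, hence the negated
    predicate.\<close>
  obtain p where p: "\<forall>z. eval B p z = Some (of_bool (\<not> P (pfst z) (psnd z)))"
    using decidable_in_not[OF P] unfolding computable_in_def by blast
  have "eval B (Mu p) x = Some (LEAST n. P x n)" for x
  proof -
    define Q where "Q n \<longleftrightarrow> eval B p (prod_encode (x, n)) = Some 0 \<and>
      (\<forall>m<n. \<exists>y. eval B p (prod_encode (x, m)) = Some (Suc y))" for n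
    have *: "Q n \<longleftrightarrow> P x n \<and> (\<forall>m<n. \<not> P x m)" for n
      unfolding Q_def by (auto simp: p of_bool_def)
    let ?n = "LEAST n. P x n"
    have "Q ?n" unfolding * using LeastI_ex[OF ex] not_less_Least by blast
    moreover have "(LEAST n. Q n) = ?n"
      using \<open>Q ?n\<close> by (rule Least_equality) (metis * not_less_Least not_le)
    ultimately show ?thesis by (auto simp: Let_def simp flip: Q_def)
  qed
  then show ?thesis unfolding computable_in_def by blast
qed

text \<open>The search for a counterexample is made total by letting it stop at the bound as well;
  the universal statement holds exactly when it gets that far.\<close>

lemma decidable_in_all_less:
  assumes P: "decidable_in B (\<lambda>z. P (pfst z) (psnd z))" and n: "computable_in B n"
  shows "decidable_in B (\<lambda>x. \<forall>m<n x. P x m)"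
proof -
  have "decidable_in B (\<lambda>x. n x \<le> (LEAST m. n x \<le> m \<or> \<not> P x m))"
    by (intro decidable_in_le n computable_in_Least decidable_in_disj decidable_in_not P
        computable_in_basic computable_in_compose[OF n]) auto
  moreover have "n x \<le> (LEAST m. n x \<le> m \<or> \<not> P x m) \<longleftrightarrow> (\<forall>m<n x. P x m)" for x
  proof
    assume le: "n x \<le> (LEAST m. n x \<le> m \<or> \<not> P x m)"
    show "\<forall>m<n x. P x m"
    proof (intro allI impI)
      fix m assume "m < n x"
      with le have "\<not> (n x \<le> m \<or> \<not> P x m)" by (intro not_less_Least) simp
      then show "P x m" by simp
    qed
  next
    assume "\<forall>m<n x. P x m"
    moreover have "n x \<le> (LEAST m. n x \<le> m \<or> \<not> P x m) \<or> \<not> P x (LEAST m. n x \<le> m \<or> \<not> P x m)"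
      by (rule LeastI[of _ "n x"]) simp
    ultimately show "n x \<le> (LEAST m. n x \<le> m \<or> \<not> P x m)" by (meson not_le)
  qed
  ultimately show ?thesis by simp
qed

lemma decidable_in_ex_less:
  assumes "decidable_in B (\<lambda>z. P (pfst z) (psnd z))" and "computable_in B n"
  shows "decidable_in B (\<lambda>x. \<exists>m<n x. P x m)"
proof -
  have "decidable_in B (\<lambda>x. \<not> (\<forall>m<n x. \<not> P x m))"
    by (intro decidable_in_not decidable_in_all_less assms)
  then show ?thesis by simp
qed

text \<open>The quotient is the least \<open>q\<close> with \<open>f x < Suc q * g x\<close>. The
  disjunct \<open>g x = 0\<close> stops the search at 0, in agreement with
  \<open>a div 0 = 0\<close>.\<close>

lemma computable_in_div:
  assumes f: "computable_in B f" and g: "computable_in B g"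
  shows "computable_in B (\<lambda>x. f x div g x)"
proof -
  have "computable_in B (\<lambda>x. LEAST q. g x = 0 \<or> f x < Suc q * g x)"
  proof (intro computable_in_Least decidable_in_disj decidable_in_eq decidable_in_less
        computable_in_mult computable_in_basic computable_in_compose[OF f]
        computable_in_compose[OF g])
    fix x
    show "\<exists>q. g x = 0 \<or> f x < Suc q * g x"
      by (metis div_less_iff_less_mult lessI neq0_conv)
  qed
  moreover have "(LEAST q. b = 0 \<or> a < Suc q * b) = a div b" for a b :: nat
  proof (cases "b = 0")
    case False
    then have "a < Suc q * b \<longleftrightarrow> a div b \<le> q" for q
      using div_less_iff_less_mult[of b a "Suc q"] by auto
    with False show ?thesis by (auto intro: Least_equality)
  qed simp
  ultimately show ?thesis by simp
qed

lemma computable_in_fact: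
  assumes "computable_in B f"
  shows "computable_in B (\<lambda>x. fact (f x))"
proof -
  have "rec_nat 1 (\<lambda>m r. Suc m * r) n = fact n" for n by (induction n) simp_all
  moreover have "computable_in B (\<lambda>x. rec_nat 1 (\<lambda>m r. Suc m * r) (f x))"
    by (intro computable_in_basic computable_in_mult assms)
  ultimately show ?thesis by simp
qed

lemma computable_in_sum:
  assumes n: "computable_in B n" and f: "computable_in B (\<lambda>z. f (pfst z) (psnd z))"
  shows "computable_in B (\<lambda>x. \<Sum>m<n x. f x m)"
proof -
  have "rec_nat 0 (\<lambda>m r. r + f x m) k = (\<Sum>m<k. f x m)" for x k by (induction k) simp_all
  moreover have "computable_in B (\<lambda>x. rec_nat 0 (\<lambda>m r. r + f x m) (n x))"
    using computable_in_compose[OF f, of "\<lambda>z. prod_encode (pfst z, pfst (psnd z))"]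
    by (intro computable_in_basic computable_in_plus n) (simp add: computable_in_basic)
  ultimately show ?thesis by simp
qed

lemmas computable_in_intros =
  computable_in_basic computable_in_if computable_in_plus computable_in_mult computable_in_diff
  computable_in_div computable_in_fact computable_in_Least computable_in_sum
  decidable_in_not decidable_in_conj decidable_in_disj decidable_in_imp
  decidable_in_le decidable_in_less decidable_in_eq decidable_in_all_less decidable_in_ex_less

section \<open>Halting questions decided by the jump\<close>

text \<open>
  Bounds on the output of a program reduce to halting, so relative to the jump no universal program
  is needed: it suffices to write down the code of a program that diverges on small outputs.
\<close>

definition halts_ge :: "nat \<Rightarrow> nat \<Rightarrow> nat \<Rightarrow> bool" where
  "halts_ge e x c \<longleftrightarrow> (\<exists>p y. prog_code p = e \<and> eval {} p x = Some y \<and> c \<le> y)"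

lemma halts_ge_prog_code: "eval {} p x = Some y \<Longrightarrow> halts_ge (prog_code p) x c \<longleftrightarrow> c \<le> y"
  unfolding halts_ge_def by (metis option.inject prog_code_inject)

text \<open>For a divergent computation, or an \<open>e\<close> that is no code,
  \<open>halts_ge\<close> holds for no \<open>c\<close>; for a convergent one it holds only up to
  the output. Partial programs are thus covered, which keeps the later searches total.\<close>

lemma not_halts_ge_eventually: "\<exists>b. \<forall>x<N. \<forall>c\<ge>b. \<not> halts_ge e x c"
proof (induction N)
  case (Suc N)
  then obtain b where b: "\<forall>x<N. \<forall>c\<ge>b. \<not> halts_ge e x c" by blast
  have "\<exists>b'. \<forall>c\<ge>b'. \<not> halts_ge e N c"
  proof (cases "\<exists>p y. prog_code p = e \<and> eval {} p N = Some y")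
    case True
    then obtain p y where "prog_code p = e" "eval {} p N = Some y" by blast
    then have "\<forall>c\<ge>Suc y. \<not> halts_ge e N c" using halts_ge_prog_code by fastforce
    then show ?thesis by blast
  qed (auto simp: halts_ge_def)
  then obtain b' where "\<forall>c\<ge>b'. \<not> halts_ge e N c" by blast
  with b have "\<forall>x<Suc N. \<forall>c\<ge>max b b'. \<not> halts_ge e x c" by (auto simp: less_Suc_eq)
  then show ?case by blast
qed simp

lemma prog_halting_iff_ge: "\<exists>p. \<forall>y c. eval {} p (prod_encode (y, c)) \<noteq> None \<longleftrightarrow> c \<le> y"
proof -
  \<comment> \<open>This function ignores the search variable, so \<open>Mu\<close> either stops at
    once, when \<open>c - y\<close> truncates to 0, or never.\<close>
  have "computable_in {} (\<lambda>z. psnd (pfst z) - pfst (pfst z))"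
    by (intro computable_in_intros)
  then obtain q where "\<forall>z. eval {} q z = Some (psnd (pfst z) - pfst (pfst z))"
    unfolding computable_in_def by blast
  then have "\<forall>y c. eval {} (Mu q) (prod_encode (y, c)) \<noteq> None \<longleftrightarrow> c \<le> y"
    by (auto simp: Let_def gr0_conv_Suc[symmetric])
  then show ?thesis by blast
qed

lemma computable_in_prog_code_const:
  assumes "computable_in B f"
  shows "computable_in B (\<lambda>x. prog_code (const_prog (f x)))"
proof -
  have "rec_nat (prog_code Zero) (\<lambda>_ r. prod_encode (6, prod_encode (prog_code Succ, r))) n
      = prog_code (const_prog n)" for n
    by (induction n) simp_all
  moreover have "computable_in B (\<lambda>x. rec_nat (prog_code Zero)
      (\<lambda>_ r. prod_encode (6, prod_encode (prog_code Succ, r))) (f x))"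
    by (intro computable_in_intros assms)
  ultimately show ?thesis by simp
qed

text \<open>From \<open>e\<close>, \<open>x\<close> and \<open>c\<close> one computes the code of a
  program that ignores its own input and halts exactly when program \<open>e\<close> outputs at
  least \<open>c\<close> on \<open>x\<close>; the jump then answers the question.\<close>

lemma decidable_in_halts_ge:
  assumes "computable_in (jump {}) e" "computable_in (jump {}) x" "computable_in (jump {}) c"
  shows "decidable_in (jump {}) (\<lambda>z. halts_ge (e z) (x z) (c z))"
proof -
  obtain r where r: "\<And>y c. eval {} r (prod_encode (y, c)) \<noteq> None \<longleftrightarrow> c \<le> y"
    using prog_halting_iff_ge by blast
  \<comment> \<open>The tags 6 and 5 are those of \<open>Comp\<close> and \<open>Tuple\<close>, and
    \<open>e\<close> stands where the code of the simulated program belongs.\<close>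
  define q where "q e x c = prod_encode (6, prod_encode (prog_code r, prod_encode (5, prod_encode
    (prod_encode (6, prod_encode (e, prog_code (const_prog x))), prog_code (const_prog c)))))"
    for e x c
  have q_prog: "q (prog_code p) x c
      = prog_code (Comp r (Tuple (Comp p (const_prog x)) (const_prog c)))" for p x c
    by (simp add: q_def)
  \<comment> \<open>If \<open>e\<close> codes no program, neither does \<open>q e x c\<close>, so
    both sides of the intended equivalence are false.\<close>
  have q_only: "\<exists>p. e = prog_code p" if "q e x c = prog_code p'" for e x c p'
  proof -
    obtain g where "prod_encode (5, prod_encode (prod_encode (6, prod_encode
        (e, prog_code (const_prog x))), prog_code (const_prog c))) = prog_code g"
      using \<open>q e x c = prog_code p'\<close> unfolding q_def by (cases p') auto
    then obtain g' where "prod_encode (6, prod_encode (e, prog_code (const_prog x))) = prog_code g'"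
      by (cases g) auto
    then show ?thesis by (cases g') auto
  qed
  have "q e x c \<in> jump {} \<longleftrightarrow> halts_ge e x c" for e x c
  proof
    assume "q e x c \<in> jump {}"
    then obtain p' where p': "prog_code p' = q e x c" "eval {} p' (q e x c) \<noteq> None"
      unfolding jump_def by auto
    then obtain p where "e = prog_code p" using q_only by metis
    with p' have "eval {} (Comp r (Tuple (Comp p (const_prog x)) (const_prog c))) (q e x c) \<noteq> None"
      using q_prog prog_code_inject by metis
    then obtain y where "eval {} p x = Some y" "c \<le> y"
      using r by (cases "eval {} p x") (auto simp: eval_const_prog)
    with \<open>e = prog_code p\<close> show "halts_ge e x c" unfolding halts_ge_def by blast
  next
    assume "halts_ge e x c"
    then obtain p y where "e = prog_code p" "eval {} p x = Some y" "c \<le> y"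
      unfolding halts_ge_def by blast
    then have "eval {} (Comp r (Tuple (Comp p (const_prog x)) (const_prog c))) (q e x c) \<noteq> None"
      using r by (simp add: eval_const_prog)
    moreover have "prog_code (Comp r (Tuple (Comp p (const_prog x)) (const_prog c))) = q e x c"
      unfolding \<open>e = prog_code p\<close> by (rule q_prog[symmetric])
    ultimately show "q e x c \<in> jump {}"
      unfolding jump_def by blast
  qed
  moreover have "decidable_in (jump {}) (\<lambda>z. q (e z) (x z) (c z) \<in> jump {})"
    unfolding q_def
    by (intro decidable_in_oracle computable_in_intros computable_in_prog_code_const assms)
  ultimately show ?thesis by simp
qed

section \<open>Partitions of the natural numbers into consecutive intervals\<close>

definition start :: "(nat \<Rightarrow> nat) \<Rightarrow> nat \<Rightarrow> nat" where
  "start m k = (\<Sum>l<k. m l)"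

definition index :: "(nat \<Rightarrow> nat) \<Rightarrow> nat \<Rightarrow> nat" where
  "index m x = (LEAST k. x < start m (Suc k))"

lemma start_0 [simp]: "start m 0 = 0"
  by (simp add: start_def)

lemma start_Suc: "start m (Suc k) = start m k + m k"
  by (simp add: start_def)

lemma start_mono: "k \<le> l \<Longrightarrow> start m k \<le> start m l"
  unfolding start_def by (intro sum_mono2) auto

lemma le_start: "(\<And>l. 0 < m l) \<Longrightarrow> k \<le> start m k"
proof (induction k)
  case (Suc k)
  have "k \<le> start m k" by (rule Suc.IH[OF Suc.prems])
  moreover have "0 < m k" by (rule Suc.prems)
  ultimately show ?case by (simp add: start_Suc)
qed simp

text \<open>With positive widths the first \<open>Suc x\<close> intervals contain at least
  \<open>Suc x\<close> points, so the search that defines \<open>index\<close> succeeds.\<close>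

lemma less_start_index:
  assumes "\<And>l. 0 < m l"
  shows "x < start m (Suc (index m x))"
proof -
  have "Suc x \<le> start m (Suc x)" by (rule le_start[OF assms])
  then show ?thesis unfolding index_def by (intro LeastI[of "\<lambda>k. x < start m (Suc k)" x]) simp
qed

lemma start_index_le: "start m (index m x) \<le> x"
proof (cases "index m x")
  case (Suc k)
  then have "\<not> x < start m (Suc k)" unfolding index_def by (intro not_less_Least) simp
  with Suc show ?thesis by simp
qed simp

lemma index_eqI:
  assumes "start m k \<le> x" "x < start m (Suc k)"
  shows "index m x = k"
  unfolding index_def
proof (rule Least_equality)
  fix l assume "x < start m (Suc l)"
  show "k \<le> l"
  proof (rule ccontr)
    assume "\<not> k \<le> l"
    then have "start m (Suc l) \<le> start m k" by (intro start_mono) simp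
    with \<open>x < start m (Suc l)\<close> assms(1) show False by simp
  qed
qed fact

lemma index_start_add: "p < m k \<Longrightarrow> index m (start m k + p) = k"
  by (rule index_eqI) (simp_all add: start_Suc)

lemma diff_start_index_less:
  assumes "\<And>l. 0 < m l"
  shows "x - start m (index m x) < m (index m x)"
  using start_index_le[of m x] less_start_index[of m x, OF assms] by (simp add: start_Suc)

section \<open>Injections and two-to-one maps that preserve the interval number\<close>

definition embed :: "(nat \<Rightarrow> nat) \<Rightarrow> (nat \<Rightarrow> nat) \<Rightarrow> nat \<Rightarrow> nat" where
  "embed m m' x = start m' (index m x) + (x - start m (index m x))"

lemma index_embed:
  assumes "\<And>k. 0 < m k" "\<And>k. m k \<le> m' k"
  shows "index m' (embed m m' x) = index m x"
proof -
  have "x - start m (index m x) < m' (index m x)"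
    using diff_start_index_less[OF assms(1)] assms(2) by (rule less_le_trans)
  then show ?thesis unfolding embed_def by (rule index_start_add)
qed

lemma inj_embed:
  assumes "\<And>k. 0 < m k" "\<And>k. m k \<le> m' k"
  shows "inj (embed m m')"
proof (rule injI)
  fix x y assume eq: "embed m m' x = embed m m' y"
  then have "index m x = index m y" using index_embed[of m m' x, OF assms] index_embed[of m m' y, OF assms] by simp
  with eq show "x = y"
    using start_index_le[of m x] start_index_le[of m y] by (simp add: embed_def)
qed

definition wrap :: "(nat \<Rightarrow> nat) \<Rightarrow> nat \<Rightarrow> nat" where
  "wrap m x = start fact (index m x) + (x - start m (index m x)) mod fact (index m x)"

text \<open>Hence a union of factorial blocks pulls back along \<open>wrap m\<close> to the union of
  the intervals with the same numbers.\<close>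

lemma index_wrap: "index fact (wrap m x) = index m x"
  unfolding wrap_def by (rule index_start_add) simp

text \<open>Offsets below \<open>fact k\<close> are unchanged by the reduction modulo
  \<open>fact k\<close>, so the beginning of interval \<open>k\<close> already covers block
  \<open>k\<close>.\<close>

lemma surj_wrap:
  assumes "\<And>k. fact k \<le> m k"
  shows "surj (wrap m)"
proof (rule surjI)
  fix y
  define k where "k = index fact y"
  define p where "p = y - start fact k"
  have p: "p < fact k" unfolding p_def k_def by (rule diff_start_index_less) simp
  then have "index m (start m k + p) = k"
    using assms[of k] by (intro index_start_add) simp
  then have "wrap m (start m k + p) = start fact k + p"
    using p by (simp add: wrap_def)
  also have "\<dots> = y" unfolding p_def k_def using start_index_le[of fact y] by simp
  finally show "wrap m (start m (index fact y) + (y - start fact (index fact y))) = y"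
    unfolding p_def k_def .
qed

text \<open>An offset below \<open>2 * fact k\<close> has quotient 0 or 1 on division by
  \<open>fact k\<close>, which leaves only two candidates for a preimage.\<close>

lemma fibres_bounded_wrap:
  assumes pos: "\<And>k. 0 < m k" and le: "\<And>k. m k \<le> 2 * fact k"
  shows "fibres_bounded (wrap m) 2"
  unfolding fibres_bounded_def
proof
  fix y
  define k where "k = index fact y"
  define a where "a = start m k + (y - start fact k)"
  have "wrap m -` {y} \<subseteq> {a, a + fact k}"
  proof
    fix x assume "x \<in> wrap m -` {y}"
    then have y: "wrap m x = y" by simp
    then have k: "index m x = k" using index_wrap[of m x] by (simp add: k_def)
    define p where "p = x - start m k"
    have p: "x = start m k + p" "p < m k"
      using start_index_le[of m x] diff_start_index_less[of m x, OF pos] by (simp_all add: p_def k)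
    have "y = start fact k + p mod fact k" using y k p(1) unfolding wrap_def by simp
    then have a: "a = start m k + p mod fact k" unfolding a_def by simp
    have "p < 2 * fact k" using p(2) le[of k] by simp
    then have "p div fact k < 2" by (simp add: div_less_iff_less_mult)
    then have "p div fact k = 0 \<or> p div fact k = 1" by linarith
    then have "p = p mod fact k \<or> p = p mod fact k + fact k"
      using div_mult_mod_eq[of p "fact k"] by (metis add.commute add_0 mult_0 mult_1)
    then show "x \<in> {a, a + fact k}" using a p(1) by auto
  qed
  moreover from this have "card (wrap m -` {y}) \<le> card {a, a + fact k}"
    by (intro card_mono) simp_all
  moreover have "card {a, a + fact k} \<le> 2" by (simp add: card_insert_if)
  ultimately show "finite (wrap m -` {y}) \<and> card (wrap m -` {y}) \<le> 2"
    using finite_subset by fastforce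
qed

lemma inj_fibres_bounded:
  assumes "inj f"
  shows "fibres_bounded f 1"
  unfolding fibres_bounded_def
proof
  show "finite (f -` {y}) \<and> card (f -` {y}) \<le> 1" for y
    using card_vimage_inj_on_le[OF assms, of "{y}"] finite_vimageI[OF _ assms, of "{y}"] by simp
qed

section \<open>Computability of interval boundaries and interval numbers\<close>

lemma computable_in_start:
  assumes m: "computable_in B (\<lambda>z. m (pfst z) (psnd z))"
    and i: "computable_in B i" and k: "computable_in B k"
  shows "computable_in B (\<lambda>x. start (m (i x)) (k x))"
proof -
  have "computable_in B (\<lambda>z. m (i (pfst z)) (psnd z))"
    using computable_in_compose[OF m, of "\<lambda>z. prod_encode (i (pfst z), psnd z)"]
    by (simp add: computable_in_basic computable_in_compose[OF i])
  then show ?thesis unfolding start_def by (intro computable_in_sum k)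
qed

lemma computable_in_index:
  assumes pos: "\<And>i k. 0 < m i k" and m: "computable_in B (\<lambda>z. m (pfst z) (psnd z))"
    and i: "computable_in B i" and x: "computable_in B x"
  shows "computable_in B (\<lambda>z. index (m (i z)) (x z))"
  unfolding index_def
proof (rule computable_in_Least)
  show "\<exists>k. x z < start (m (i z)) (Suc k)" for z
    using less_start_index[of "m (i z)"] pos by blast
qed (intro computable_in_intros computable_in_start m computable_in_compose[OF i]
    computable_in_compose[OF x])

lemma block_start_eq: "block_start k = start fact k"
  by (induction k) (simp_all add: start_Suc)

lemma index_block: "x \<in> block k \<Longrightarrow> index fact x = k"
  by (rule index_eqI) (simp_all add: block_def block_start_eq[symmetric])

section \<open>The diagonalisation\<close>

text \<open>Isolates what the diagonalisation uses of the integer widths. Here \<open>wide\<close>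
  condenses the gap between two profiles on an infinite set into the counting inequality that
  defeats injections, at arbitrarily late blocks.\<close>

locale block_widths =
  fixes m :: "nat \<Rightarrow> nat \<Rightarrow> nat" and D :: "(nat \<times> nat) set"
  assumes fact_le: "fact k \<le> m i k"
    and le_fact: "m i k \<le> 2 * fact k"
    and wide: "(i, j) \<in> D \<Longrightarrow> \<exists>k\<ge>K. start (m j) (Suc k) < m i k"
    and computable_m: "computable_in {} (\<lambda>z. m (pfst z) (psnd z))"
    and decidable_D: "decidable_in {} (\<lambda>z. prod_decode z \<in> D)"
begin

lemma m_pos: "0 < m i k"
  by (rule less_le_trans[OF fact_gt_zero fact_le])

text \<open>For pairs outside \<open>D\<close> the implication makes the value \<open>K\<close>, so
  that every stage is defined.\<close>

definition wide_block :: "nat \<Rightarrow> nat \<Rightarrow> nat \<Rightarrow> nat" where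
  "wide_block i j K = (LEAST k. K \<le> k \<and> ((i, j) \<in> D \<longrightarrow> start (m j) (Suc k) < m i k))"

text \<open>The last interval of \<open>C_j\<close> that program \<open>e\<close> reaches from
  interval \<open>k\<close> of \<open>C_i\<close>, or \<open>k\<close> if it reaches none beyond
  \<open>k\<close>. Inputs on which the program diverges impose no condition.\<close>

definition escape_block :: "nat \<Rightarrow> nat \<Rightarrow> nat \<Rightarrow> nat \<Rightarrow> nat" where
  "escape_block e i j k = (LEAST k'. k \<le> k' \<and>
     (\<forall>x<start (m i) (Suc k). start (m i) k \<le> x \<longrightarrow> \<not> halts_ge e x (start (m j) (Suc k'))))"

text \<open>
  Stage \<open>n\<close> encodes \<open>(e, i, j)\<close> and refutes that the program with code \<open>e\<close> reduces \<open>C\<^sub>i\<close> to \<open>C\<^sub>j\<close>;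
  it decides membership of the blocks from \<open>stage n\<close> up to, and excluding, \<open>stage (Suc n)\<close>, of which
  only the last one is put into \<open>A\<close>.
\<close>

primrec stage :: "nat \<Rightarrow> nat" where
  "stage 0 = 0"
| "stage (Suc n) = Suc (escape_block (pfst n) (pfst (psnd n)) (psnd (psnd n))
     (wide_block (pfst (psnd n)) (psnd (psnd n)) (stage n)))"

definition selected :: "nat set" where
  "selected = {k. \<exists>n. stage (Suc n) = Suc k}"

lemma ex_wide_block: "\<exists>k. K \<le> k \<and> ((i, j) \<in> D \<longrightarrow> start (m j) (Suc k) < m i k)"
  using wide[of i j K] by (cases "(i, j) \<in> D") auto

text \<open>The outputs on one interval are bounded, while positive widths make the interval ends of
  \<open>C_j\<close> unbounded.\<close>

lemma ex_escape_block:
  "\<exists>k'. k \<le> k' \<and>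
     (\<forall>x<start (m i) (Suc k). start (m i) k \<le> x \<longrightarrow> \<not> halts_ge e x (start (m j) (Suc k')))"
proof -
  obtain b where b: "\<forall>x<start (m i) (Suc k). \<forall>c\<ge>b. \<not> halts_ge e x c"
    using not_halts_ge_eventually by blast
  have "Suc (max k b) \<le> start (m j) (Suc (max k b))" by (rule le_start) (rule m_pos)
  then have "b \<le> start (m j) (Suc (max k b))" by simp
  with b show ?thesis by (intro exI[of _ "max k b"]) auto
qed

lemmas wide_block_props = LeastI_ex[OF ex_wide_block, folded wide_block_def]
lemmas escape_block_props = LeastI_ex[OF ex_escape_block, folded escape_block_def]

lemma stage_less_Suc: "stage n < stage (Suc n)"
proof -
  let ?k = "wide_block (pfst (psnd n)) (psnd (psnd n)) (stage n)"
  have "stage n \<le> ?k" using wide_block_props by blast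
  also have "\<dots> \<le> escape_block (pfst n) (pfst (psnd n)) (psnd (psnd n)) ?k"
    using escape_block_props by blast
  finally show ?thesis by simp
qed

lemma strict_mono_stage: "strict_mono stage"
  using stage_less_Suc by (simp add: strict_mono_Suc_iff)

text \<open>Strict growth of \<open>stage\<close> bounds the stage at which block \<open>k\<close>
  can be selected, which makes the question decidable from the stages.\<close>

lemma selected_iff_bounded: "k \<in> selected \<longleftrightarrow> (\<exists>n<Suc k. stage (Suc n) = Suc k)"
proof
  assume "k \<in> selected"
  then obtain n where n: "stage (Suc n) = Suc k" unfolding selected_def by blast
  have "Suc n \<le> stage (Suc n)" by (rule strict_mono_imp_increasing[OF strict_mono_stage])
  then have "n < Suc k" unfolding n by simp
  with n show "\<exists>n<Suc k. stage (Suc n) = Suc k" by blast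
qed (auto simp only: selected_def)

text \<open>Otherwise \<open>Suc k\<close> would be a stage value strictly between two consecutive
  ones.\<close>

lemma between_stages_not_selected:
  assumes "stage n \<le> k" "Suc k < stage (Suc n)"
  shows "k \<notin> selected"
proof
  assume "k \<in> selected"
  then obtain l where l: "stage (Suc l) = Suc k" unfolding selected_def by blast
  then have "stage n < stage (Suc l)" "stage (Suc l) < stage (Suc n)"
    using assms unfolding l by linarith+
  then have "n < Suc l" "Suc l < Suc n" unfolding strict_mono_less[OF strict_mono_stage] .
  then show False by simp
qed

section \<open>Computability of the construction relative to the jump\<close>

lemma computable_in_m:
  assumes "computable_in B i" "computable_in B k"
  shows "computable_in B (\<lambda>x. m (i x) (k x))"
  using computable_in_compose[OF computable_in_mono[OF computable_m] computable_in_pair[OF assms]]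
  by simp

lemma computable_in_start_m:
  assumes "computable_in B i" "computable_in B k"
  shows "computable_in B (\<lambda>x. start (m (i x)) (k x))"
  by (rule computable_in_start[of B m, OF computable_in_mono[OF computable_m] assms])

lemma computable_in_index_m:
  assumes "computable_in B i" "computable_in B x"
  shows "computable_in B (\<lambda>z. index (m (i z)) (x z))"
  by (rule computable_in_index[of m B, OF m_pos computable_in_mono[OF computable_m] assms])

lemma decidable_in_D:
  assumes "computable_in B i" "computable_in B j"
  shows "decidable_in B (\<lambda>x. (i x, j x) \<in> D)"
  using computable_in_compose[OF computable_in_mono[OF decidable_D] computable_in_pair[OF assms]]
  by simp

lemma computable_in_wide_block:
  assumes "computable_in B i" "computable_in B j" "computable_in B K"
  shows "computable_in B (\<lambda>x. wide_block (i x) (j x) (K x))"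
  unfolding wide_block_def
  by (intro computable_in_Least ex_wide_block computable_in_intros computable_in_m
      computable_in_start_m decidable_in_D assms[THEN computable_in_compose])

text \<open>Here the oracle is consulted: each candidate \<open>k'\<close> needs finitely many
  questions \<open>halts_ge\<close>.\<close>

lemma computable_in_escape_block:
  assumes "computable_in (jump {}) e" "computable_in (jump {}) i" "computable_in (jump {}) j"
    "computable_in (jump {}) k"
  shows "computable_in (jump {}) (\<lambda>x. escape_block (e x) (i x) (j x) (k x))"
  unfolding escape_block_def
  by (intro computable_in_Least ex_escape_block computable_in_intros decidable_in_halts_ge
      computable_in_start_m assms[THEN computable_in_compose])

lemma computable_in_stage:
  assumes "computable_in (jump {}) f"
  shows "computable_in (jump {}) (\<lambda>x. stage (f x))"
  unfolding stage_def
  by (intro computable_in_escape_block computable_in_wide_block computable_in_intros assms)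

lemma decidable_in_selected:
  assumes "computable_in (jump {}) f"
  shows "decidable_in (jump {}) (\<lambda>x. f x \<in> selected)"
  unfolding selected_iff_bounded
  by (intro computable_in_stage computable_in_intros assms[THEN computable_in_compose])

lemma not_one_reducible:
  assumes "(i, j) \<in> D"
  shows "\<not> {x. index (m i) x \<in> selected} \<le>\<^sub>1 {x. index (m j) x \<in> selected}"
proof
  assume "{x. index (m i) x \<in> selected} \<le>\<^sub>1 {x. index (m j) x \<in> selected}"
  then obtain f p where p: "\<And>x. eval {} p x = Some (f x)" and "inj f"
    and reduces: "\<And>x. index (m i) x \<in> selected \<longleftrightarrow> index (m j) (f x) \<in> selected"
    unfolding one_reducible_def computable_eq_computable_in computable_in_def by auto
  have halts_iff: "halts_ge (prog_code p) x c \<longleftrightarrow> c \<le> f x" for x c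
    by (rule halts_ge_prog_code) (rule p)
  \<comment> \<open>The stage devoted to this program and this pair.\<close>
  define n where "n = prod_encode (prog_code p, prod_encode (i, j))"
  define k where "k = wide_block i j (stage n)"
  define k' where "k' = escape_block (prog_code p) i j k"
  have k: "stage n \<le> k" "start (m j) (Suc k) < m i k"
    using wide_block_props[of "stage n" i j] assms unfolding k_def by simp_all
  have stage_Suc: "stage (Suc n) = Suc k'" by (simp add: n_def k'_def k_def)
  have k': "k \<le> k'"
    and k'_bound: "\<And>x. x < start (m i) (Suc k) \<Longrightarrow> start (m i) k \<le> x \<Longrightarrow> f x < start (m j) (Suc k')"
    using escape_block_props[of k "prog_code p" i j] unfolding k'_def halts_iff not_le by blast+
  \<comment> \<open>By minimality of \<open>k'\<close>, any smaller \<open>l\<close> from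
    \<open>k\<close> on is still exceeded by some value of \<open>f\<close> on the interval.\<close>
  have escape: "\<exists>x<start (m i) (Suc k). start (m i) k \<le> x \<and> start (m j) (Suc l) \<le> f x"
    if "k \<le> l" "l < k'" for l
    using not_less_Least[OF that(2)[unfolded k'_def escape_block_def]] that(1)
    unfolding halts_iff by blast
  \<comment> \<open>Pigeonhole: otherwise \<open>f\<close> would inject \<open>m i k\<close> points
    into the fewer points of the first \<open>Suc k\<close> intervals of \<open>C_j\<close>.\<close>
  have "k \<noteq> k'"
  proof
    assume "k = k'"
    then have "f ` {start (m i) k..<start (m i) (Suc k)} \<subseteq> {..<start (m j) (Suc k)}"
      using k'_bound by auto
    then have "card (f ` {start (m i) k..<start (m i) (Suc k)}) \<le> start (m j) (Suc k)"
      using card_mono[OF finite_lessThan] by fastforce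
    moreover have "card (f ` {start (m i) k..<start (m i) (Suc k)}) = m i k"
      using \<open>inj f\<close> by (simp add: card_image inj_on_subset start_Suc)
    ultimately show False using k(2) by simp
  qed
  with k' have "k < k'" by simp
  \<comment> \<open>Minimality is applied to the predecessor of \<open>k'\<close>: the end of
    interval \<open>l\<close> is the start of interval \<open>k'\<close>, so some value of
    \<open>f\<close> lies exactly in interval \<open>k'\<close>.\<close>
  then obtain l where l: "k' = Suc l" "k \<le> l" by (cases k') auto
  then obtain x where x: "x < start (m i) (Suc k)" "start (m i) k \<le> x" "start (m j) k' \<le> f x"
    using escape[of l] by auto
  then have "index (m i) x = k" "index (m j) (f x) = k'"
    using k'_bound by (auto intro!: index_eqI)
  moreover have "k \<notin> selected"
    using between_stages_not_selected[of n k] k(1) \<open>k < k'\<close> stage_Suc by simp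
  moreover have "k' \<in> selected" unfolding selected_def using stage_Suc by blast
  ultimately show False using reduces[of x] by simp
qed

end

section \<open>Block widths from density profiles\<close>

text \<open>In the induction step the earlier sum is at most \<open>2 * fact n\<close>, hence at
  most \<open>fact (Suc n)\<close> as soon as \<open>n\<close> is positive; the step from
  \<open>n = 0\<close> is checked directly.\<close>

lemma start_fact_Suc_le: "start fact (Suc n) \<le> 2 * fact n"
proof (induction n)
  case (Suc n)
  show ?case
  proof (cases n)
    case (Suc l)
    have "2 * fact n \<le> (fact (Suc n) :: nat)"
      unfolding fact_Suc using Suc by (intro mult_right_mono) simp_all
    with \<open>start fact (Suc n) \<le> 2 * fact n\<close> show ?thesis
      by (simp only: start_Suc[of fact "Suc n"])
  qed (simp add: start_Suc)
qed (simp add: start_Suc)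

lemma start_le_mult:
  assumes "\<And>k. m k \<le> c * m' k"
  shows "start m k \<le> c * start m' k"
  unfolding start_def sum_distrib_left by (intro sum_mono assms)

definition width :: "(nat \<Rightarrow> rat) \<Rightarrow> nat \<Rightarrow> nat" where
  "width v k = nat \<lfloor>v k * fact k\<rfloor>"

lemma fact_le_width:
  assumes "block_density_profile v"
  shows "fact k \<le> width v k"
proof -
  have "1 * fact k \<le> v k * fact k"
    using assms unfolding block_density_profile_def by (intro mult_right_mono less_imp_le) auto
  then have "int (fact k) \<le> \<lfloor>v k * fact k\<rfloor>" by (simp add: le_floor_iff)
  then show ?thesis unfolding width_def by linarith
qed

lemma width_le_fact:
  assumes "block_density_profile v"
  shows "width v k \<le> 2 * fact k"
proof -
  have "v k * fact k \<le> 2 * fact k"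
    using assms unfolding block_density_profile_def by (intro mult_right_mono less_imp_le) auto
  then have "\<lfloor>v k * fact k\<rfloor> \<le> \<lfloor>of_int (2 * fact k) :: rat\<rfloor>" by (intro floor_mono) simp
  then have "\<lfloor>v k * fact k\<rfloor> \<le> int (2 * fact k)" by (simp only: floor_of_int) simp
  then show ?thesis unfolding width_def by linarith
qed

lemma width_mono: "v k \<le> w k \<Longrightarrow> width v k \<le> width w k"
  unfolding width_def by (intro nat_mono floor_mono mult_right_mono) auto

lemma nat_fact: "nat (fact k) = fact k"
  by (metis nat_int of_nat_fact)

text \<open>Computes the floor by integer division from the code of the rational. A nonnegative
  numerator \<open>p\<close> is encoded by \<open>int_encode\<close> as \<open>2 * p\<close>, which
  explains \<open>div 2\<close>.\<close>

lemma width_eq_rat_encode: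
  assumes "0 \<le> v k"
  shows "width v k = pfst (rat_encode (v k)) div 2 * fact k div psnd (rat_encode (v k))"
proof -
  obtain p q where pq: "quotient_of (v k) = (p, q)" by (cases "quotient_of (v k)")
  then have "0 < q" and v: "v k = of_int p / of_int q"
    using quotient_of_denom_pos quotient_of_div by blast+
  with assms have "0 \<le> p" by (simp add: zero_le_divide_iff)
  have "v k * fact k = of_int (p * fact k) / of_int q" by (simp add: v)
  then have "width v k = nat (p * fact k div q)"
    unfolding width_def by (simp only: floor_divide_of_int_eq)
  also have "\<dots> = nat p * fact k div nat q"
    using \<open>0 \<le> p\<close> \<open>0 < q\<close> by (simp add: nat_div_distrib nat_mult_distrib nat_fact)
  finally show ?thesis
    using \<open>0 \<le> p\<close> by (simp add: rat_encode_def pq int_encode_def sum_encode_def)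
qed

text \<open>With \<open>k = Suc n\<close>, the gap contributes \<open>d * k * fact n\<close>, more
  than \<open>5 * fact n\<close>. Four of these five parts outweigh all earlier intervals, and the
  fifth pays for rounding down.\<close>

lemma start_width_less_width:
  assumes v: "block_density_profile v" and w: "block_density_profile w"
    and le: "w k + d \<le> v k" and k: "5 < d * of_nat k" "0 < k"
  shows "start (width w) (Suc k) < width v k"
proof -
  obtain n where n: "k = Suc n" using k(2) by (cases k) auto
  have "of_nat (width w k) \<le> w k * fact k"
    using w unfolding width_def block_density_profile_def
    by (metis floor_correct mult_nonneg_nonneg fact_ge_zero less_imp_le less_trans zero_less_one
        of_nat_nat zero_le_floor)
  moreover have "v k * fact k < of_nat (width v k) + 1"
    unfolding width_def by linarith
  moreover have "w k * fact k + d * of_nat k * fact n \<le> v k * fact k"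
    using mult_right_mono[OF le, of "fact k"] by (simp add: n algebra_simps)
  moreover have "5 * fact n < d * of_nat k * fact n"
    using k(1) by (intro mult_strict_right_mono) auto
  moreover have "(1 :: rat) \<le> fact n" by (rule fact_ge_1)
  moreover have "(of_nat (start (width w) k) :: rat) \<le> 4 * fact n"
  proof -
    have "start (width w) k \<le> 2 * start fact k" by (intro start_le_mult width_le_fact w)
    also have "\<dots> \<le> 4 * fact n" using start_fact_Suc_le[of n] by (simp add: n)
    finally show ?thesis by (metis of_nat_fact of_nat_le_iff of_nat_mult of_nat_numeral)
  qed
  ultimately have "(of_nat (start (width w) k + width w k) :: rat) < of_nat (width v k)"
    unfolding of_nat_add by linarith
  then show ?thesis unfolding start_Suc of_nat_less_iff .
qed

lemma ex_start_width_less_width: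
  assumes "block_density_profile v" "block_density_profile w" and "0 < d" "infinite S"
    and "\<And>k. k \<in> S \<Longrightarrow> w k + d \<le> v k"
  shows "\<exists>k\<ge>K. start (width w) (Suc k) < width v k"
proof -
  obtain c where c: "5 / d < of_nat c" using reals_Archimedean2 by blast
  \<comment> \<open>The summand \<open>K\<close> gives the required lower bound, \<open>c\<close>
    makes \<open>d * k\<close> exceed 5, and 1 keeps \<open>k\<close> positive.\<close>
  obtain k where k: "k \<in> S" "K + c + 1 \<le> k"
    using \<open>infinite S\<close> unfolding finite_nat_set_iff_bounded_le by (meson nat_le_linear)
  have "of_nat c \<le> (of_nat k :: rat)" using k(2) by simp
  with c have "5 / d < of_nat k" by (rule less_le_trans)
  then have "5 < d * of_nat k" using \<open>0 < d\<close> by (simp add: field_simps)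
  then have "start (width w) (Suc k) < width v k"
    using k assms by (intro start_width_less_width[of v w k d]) simp_all
  with k(2) show ?thesis by (intro exI[of _ k]) simp
qed

theorem theorem3p2:
  fixes u :: "nat \<Rightarrow> nat \<Rightarrow> rat"
    and D :: "(nat \<times> nat) set"
    and \<delta> :: "nat \<Rightarrow> nat \<Rightarrow> rat"
    and s :: "nat \<Rightarrow> nat \<Rightarrow> nat \<Rightarrow> nat"
  assumes "\<And>i. block_density_profile (u i)"
    and "computable (uncurry2 (\<lambda>i k. rat_encode (u i k)))"
    and "computable_set (prod_encode ` D)"
    and "computable_on (prod_encode ` D) (uncurry2 (\<lambda>i j. rat_encode (\<delta> i j)))"
    and "\<And>i j. (i, j) \<in> D \<Longrightarrow> \<delta> i j > 0"
    and "computable_on {prod_encode (prod_encode (i, j), t) | i j t. (i, j) \<in> D} (uncurry3 s)"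
    and "\<And>i j. (i, j) \<in> D \<Longrightarrow> strict_mono (s i j)"
    and "\<And>i j. (i, j) \<in> D \<Longrightarrow> infinite (range (s i j))"
    and "\<And>i j k. (i, j) \<in> D \<Longrightarrow> k \<in> range (s i j) \<Longrightarrow> u i k \<ge> u j k + \<delta> i j"
  shows "\<exists>(A :: nat set) (h :: nat \<Rightarrow> nat \<Rightarrow> nat).
    set_computable_in (jump {}) A \<and>
    computable (uncurry2 h) \<and>
    (\<forall>i. surj (h i)) \<and>
    (\<forall>k. \<forall>x\<in>block k. \<forall>y\<in>block k. x \<in> A \<longleftrightarrow> y \<in> A) \<and>
    (\<forall>i. fibres_bounded (h i) 2) \<and>
    (let C = (\<lambda>i. {x. h i x \<in> A}) in
      (\<forall>i. C i \<equiv>\<^sub>b\<^sub>f\<^sub>o A) \<and>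
      (\<forall>i j. (\<forall>k. u i k \<le> u j k) \<longrightarrow> C i \<le>\<^sub>1 C j) \<and>
      (\<forall>i j. (i, j) \<in> D \<longrightarrow> \<not> C i \<le>\<^sub>1 C j) \<and>
      (\<forall>i j. (\<forall>k. u i k \<le> u j k) \<and> (j, i) \<in> D \<longrightarrow> C i <\<^sub>1 C j))"
proof -
  interpret block_widths "\<lambda>i. width (u i)" D
  proof
    fix i j k K
    show "fact k \<le> width (u i) k" by (intro fact_le_width assms)
    show "width (u i) k \<le> 2 * fact k" by (intro width_le_fact assms)
    show "\<exists>k\<ge>K. start (width (u j)) (Suc k) < width (u i) k" if "(i, j) \<in> D"
      using that assms(1,5,8,9) by (intro ex_start_width_less_width[of _ _ "\<delta> i j" "range (s i j)"])
  next
    have "computable_in {} (\<lambda>z. rat_encode (u (pfst z) (psnd z)))"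
      using assms(2) by (simp add: computable_eq_computable_in uncurry2_def split_beta)
    then have "computable_in {} (\<lambda>z. pfst (rat_encode (u (pfst z) (psnd z))) div 2 * fact (psnd z)
        div psnd (rat_encode (u (pfst z) (psnd z))))"
      by (intro computable_in_intros)
    moreover have "0 \<le> u i k" for i k
      using assms(1)[of i] unfolding block_density_profile_def by (meson less_imp_le less_trans zero_less_one)
    ultimately show "computable_in {} (\<lambda>z. width (u (pfst z)) (psnd z))"
      by (simp add: width_eq_rat_encode)
    have "z \<in> prod_encode ` D \<longleftrightarrow> prod_decode z \<in> D" for z by force
    then show "decidable_in {} (\<lambda>z. prod_decode z \<in> D)"
      using assms(3) by (simp add: computable_set_def set_computable_in_eq)
  qed
  define A where "A = {x. index fact x \<in> selected}"
  define h where "h i = wrap (width (u i))" for i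
  have computable_fact: "computable_in B (\<lambda>z. fact (psnd z))" for B
    by (intro computable_in_intros)
  have computable_in_start_fact: "computable_in B k \<Longrightarrow> computable_in B (\<lambda>x. start fact (k x))"
    for B k
    using computable_in_start[of B "\<lambda>_. fact"] computable_fact computable_in_const by blast
  have computable_in_index_fact: "computable_in B x \<Longrightarrow> computable_in B (\<lambda>z. index fact (x z))"
    for B x
    using computable_in_index[of "\<lambda>_. fact" B] computable_fact computable_in_const
    by (simp add: fact_gt_zero)
  \<comment> \<open>\<open>C_i\<close> depends on a point only through its interval number, so all
    reductions can be argued about intervals.\<close>
  have C: "{x. h i x \<in> A} = {x. index (width (u i)) x \<in> selected}" for i
    by (simp add: A_def h_def index_wrap)
  have fibres: "fibres_bounded (h i) 2" for i
    unfolding h_def by (intro fibres_bounded_wrap m_pos le_fact)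
  have computable_h: "computable_in {} (\<lambda>z. h (pfst z) (psnd z))"
    \<comment> \<open>The remainder is rewritten as \<open>a - a div b * b\<close>, to which the
      closure rules apply.\<close>
    unfolding h_def wrap_def minus_div_mult_eq_mod[symmetric]
    by (intro computable_in_start_fact computable_in_intros computable_in_index_m
        computable_in_start_m)
  have red: "{x. index (width (u i)) x \<in> selected} \<le>\<^sub>1 {x. index (width (u j)) x \<in> selected}"
    if "\<forall>k. u i k \<le> u j k" for i j
  proof -
    have le: "width (u i) k \<le> width (u j) k" for k using that by (intro width_mono) simp
    have "computable_in {} (embed (width (u i)) (width (u j)))"
      unfolding embed_def[abs_def]
      by (intro computable_in_intros computable_in_index_m computable_in_start_m)
    then show ?thesis
      unfolding one_reducible_def computable_eq_computable_in
      using inj_embed[OF m_pos le] index_embed[OF m_pos le] by auto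
  qed
  have not_red: "\<not> {x. index (width (u i)) x \<in> selected} \<le>\<^sub>1 {x. index (width (u j)) x \<in> selected}"
    if "(i, j) \<in> D" for i j
    using that by (rule not_one_reducible)
  have bfo: "{x. h i x \<in> A} \<equiv>\<^sub>b\<^sub>f\<^sub>o A" for i
    unfolding bfo_equivalent_def
  proof
    have "computable (h i)"
      using computable_in_compose[OF computable_h, of "\<lambda>x. prod_encode (i, x)"]
      by (simp add: computable_eq_computable_in computable_in_intros)
    then show "{x. h i x \<in> A} \<le>\<^sub>b\<^sub>f\<^sub>o A"
      unfolding bfo_reducible_def using fibres[of i] by (intro exI[of _ "h i"] exI[of _ 2]) simp
    \<comment> \<open>The reverse reduction is injective: block \<open>k\<close> of \<open>A\<close>
      fits into the wider interval \<open>k\<close> of \<open>C_i\<close>.\<close>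
    define g where "g = embed fact (width (u i))"
    have "inj g" unfolding g_def by (intro inj_embed fact_le) simp
    have "computable_in {} g"
      unfolding g_def embed_def[abs_def]
      by (intro computable_in_intros computable_in_index_fact computable_in_start_fact
          computable_in_start_m)
    moreover have "index (width (u i)) (g x) = index fact x" for x
      unfolding g_def by (intro index_embed fact_le) simp
    moreover have "fibres_bounded g 1" using \<open>inj g\<close> by (rule inj_fibres_bounded)
    ultimately show "A \<le>\<^sub>b\<^sub>f\<^sub>o {x. h i x \<in> A}"
      unfolding bfo_reducible_def computable_eq_computable_in
      by (intro exI[of _ g] exI[of _ 1]) (simp add: A_def h_def index_wrap)
  qed
  show ?thesis
  proof (intro exI[of _ A] exI[of _ h] conjI)
    show "set_computable_in (jump {}) A"
      unfolding set_computable_in_eq A_def mem_Collect_eq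
      by (intro decidable_in_selected computable_in_index_fact computable_in_id)
    show "computable (uncurry2 h)"
      using computable_h by (simp add: computable_eq_computable_in uncurry2_def split_beta)
    show "\<forall>i. surj (h i)" unfolding h_def by (intro allI surj_wrap fact_le)
    show "\<forall>k. \<forall>x\<in>block k. \<forall>y\<in>block k. x \<in> A \<longleftrightarrow> y \<in> A"
      by (auto simp: A_def index_block)
    show "\<forall>i. fibres_bounded (h i) 2" using fibres by blast
    show "let C = \<lambda>i. {x. h i x \<in> A} in
      (\<forall>i. C i \<equiv>\<^sub>b\<^sub>f\<^sub>o A) \<and>
      (\<forall>i j. (\<forall>k. u i k \<le> u j k) \<longrightarrow> C i \<le>\<^sub>1 C j) \<and>
      (\<forall>i j. (i, j) \<in> D \<longrightarrow> \<not> C i \<le>\<^sub>1 C j) \<and>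
      (\<forall>i j. (\<forall>k. u i k \<le> u j k) \<and> (j, i) \<in> D \<longrightarrow> C i <\<^sub>1 C j)"
      using bfo red not_red unfolding Let_def C one_less_def by blast
  qed
qed

end
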